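(* Let $(X,B)$ be an $(r,k,\lambda)$-BIBD. Let $\epsilon$ be a positive real number and let $t\ge 2$ be an integer. Let $L\subseteq B$ with $$|L| \geq (1+\epsilon)(t-1)\frac{|X|}{k}.$$ Then the number $\Gamma_t(L)$ of $t$-rich points satisfies $$\Gamma_t(L) \geq b\,|X|,\qquad\text{where}\qquad b = \frac{\epsilon^2(t-1)}{\epsilon^2(t-1) + \frac{r-\lambda}{k}(1+\epsilon)}.$$
   Context: Let $X$ be a finite nonempty set (the points) and let $B$ be a set of subsets of $X$ (the blocks). For integers $r,k\ge 1$ and $\lambda \ge 0$, $(X,B)$ is an $(r,k,\lambda)$-BIBD (balanced incomplete block design) if: each point is in exactly $r$ blocks; each block contains exactly $k$ points; each pair of distinct points is contained in exactly $\lambda$ blocks; and no single block contains all of the points. Given $L\subseteq B$, a point $x\in X$ is $t$-rich if it is contained in at least $t$ blocks of $L$, and $\Gamma_t(L) = |\{x\in X : |\{b\in L : x\in b\}|\ge t\}|$ is the number of $t$-rich points. *)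

theory Defs
  imports Complex_Main
begin

definition bibd :: "'a set \<Rightarrow> 'a set set \<Rightarrow> nat \<Rightarrow> nat \<Rightarrow> nat \<Rightarrow> bool" where
  "bibd X B r k l \<longleftrightarrow>
     finite X \<and> X \<noteq> {} \<and> B \<subseteq> Pow X \<and> r \<ge> 1 \<and> k \<ge> 1 \<and>
     (\<forall>x\<in>X. card {b \<in> B. x \<in> b} = r) \<and>
     (\<forall>b\<in>B. card b = k) \<and>
     (\<forall>x\<in>X. \<forall>y\<in>X. x \<noteq> y \<longrightarrow> card {b \<in> B. x \<in> b \<and> y \<in> b} = l) \<and>
     (\<forall>b\<in>B. b \<noteq> X)"

definition rich_points :: "'a set \<Rightarrow> nat \<Rightarrow> 'a set set \<Rightarrow> 'a set" where
  "rich_points X t L = {x \<in> X. card {b \<in> L. x \<in> b} \<ge> t}"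

definition num_rich :: "'a set \<Rightarrow> nat \<Rightarrow> 'a set set \<Rightarrow> nat" where
  "num_rich X t L = card (rich_points X t L)"

end

theory Submission
  imports Defs "HOL-Analysis.Convex"
begin

text \<open>
  Let \<open>d x\<close> be the number of blocks of \<open>L\<close> through the point \<open>x\<close>, let \<open>\<mu> = card L * k / card X\<close>
  be its mean over \<open>X\<close>, and let \<open>f = d - \<mu>\<close>, a function with sum zero. Every two distinct points
  lie in exactly \<open>l\<close> common blocks, so the incidence matrix \<open>N\<close> satisfies
  \<open>N N\<^sup>T = (r - l) I + l J\<close> with \<open>J\<close> the all-ones matrix. Hence \<open>N\<^sup>T\<close> scales the squared
  length of a zero-sum vector by exactly \<open>r - l\<close> (\<open>sum_block_sum_squares\<close>).
  Summing the block sums of \<open>f\<close> over \<open>L\<close> alone gives back \<open>\<Sum>f\<^sup>2\<close>, and Cauchy-Schwarz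
  then yields \<open>\<Sum>f\<^sup>2 \<le> (r - l) * card L\<close> (\<open>degree_variance_le\<close>): a set of
  blocks covers the points nearly uniformly.

  A point that is not \<open>t\<close>-rich has \<open>d x \<le> t - 1\<close>, which is at least \<open>\<mu> - (t - 1) > 0\<close> below the
  mean. One-sided concentration (\<open>card_below_mean_le\<close>, Cantelli's inequality) bounds the number of
  such points. It is the one-sided form, rather than Chebyshev's inequality, that gives a bound of
  the shape \<open>A / (A + C)\<close>. That bound improves as \<open>\<mu>\<close> grows, so the extreme case is
  \<open>\<mu> = (1 + \<epsilon>) (t - 1)\<close>, where it is the stated constant times \<open>card X\<close>.
\<close>

text \<open>
  With \<open>S\<close> the points far below zero, zero sum forces \<open>f\<close> to have total at least \<open>a * card S\<close> on
  \<open>X - S\<close>, so by Cauchy-Schwarz both \<open>S\<close> and its complement contribute to the sum of squares.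
  Clearing the denominators of Cantelli's inequality makes it valid also for \<open>S = X\<close>.
\<close>

lemma card_below_mean_le:
  fixes f :: "'a \<Rightarrow> real" and a :: real
  assumes fin: "finite X" and sub: "S \<subseteq> X" and zero: "sum f X = 0" and a: "a \<ge> 0"
    and low: "\<And>x. x \<in> S \<Longrightarrow> f x \<le> - a"
  shows "a\<^sup>2 * card S * card X \<le> card (X - S) * (\<Sum>x\<in>X. (f x)\<^sup>2)"
proof -
  let ?T = "X - S"
  have finS: "finite S" using fin sub finite_subset by blast
  have "sum f S \<le> (\<Sum>x\<in>S. - a)" by (rule sum_mono) (rule low)
  moreover have "sum f X = sum f ?T + sum f S" by (rule sum.subset_diff[OF sub fin])
  ultimately have "a * card S \<le> sum f ?T" using zero by (simp add: mult.commute)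
  then have "(a * card S)\<^sup>2 \<le> (sum f ?T)\<^sup>2" using a by (intro power_mono) auto
  also have "\<dots> \<le> (\<Sum>x\<in>?T. (f x)\<^sup>2) * card ?T" by (rule sum_squared_le_sum_of_squares)
  finally have T: "(a * card S)\<^sup>2 \<le> (\<Sum>x\<in>?T. (f x)\<^sup>2) * card ?T" .
  have "a\<^sup>2 \<le> (f x)\<^sup>2" if "x \<in> S" for x
    using power_mono[of a "- f x" 2] low[OF that] a by simp
  then have "(\<Sum>x\<in>S. a\<^sup>2) \<le> (\<Sum>x\<in>S. (f x)\<^sup>2)" by (rule sum_mono)
  then have "a\<^sup>2 * card S * card ?T \<le> (\<Sum>x\<in>S. (f x)\<^sup>2) * card ?T"
    by (intro mult_right_mono) (auto simp: mult.commute)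
  moreover have "card X = card ?T + card S"
    using card_Diff_subset[OF finS sub] card_mono[OF fin sub] by simp
  moreover have "(\<Sum>x\<in>X. (f x)\<^sup>2) = (\<Sum>x\<in>?T. (f x)\<^sup>2) + (\<Sum>x\<in>S. (f x)\<^sup>2)"
    by (rule sum.subset_diff[OF sub fin])
  ultimately show ?thesis using T by (simp add: algebra_simps power2_eq_square)
qed

lemma sum_block_swap:
  fixes f :: "'a \<Rightarrow> real"
  assumes "finite X" "finite A" "A \<subseteq> Pow X"
  shows "(\<Sum>b\<in>A. \<Sum>x\<in>b. f x) = (\<Sum>x\<in>X. card {b \<in> A. x \<in> b} * f x)"
proof -
  have "(\<Sum>b\<in>A. \<Sum>x\<in>b. f x) = (\<Sum>b\<in>A. \<Sum>x\<in>{x \<in> X. x \<in> b}. f x)"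
    using assms(3) by (intro sum.cong) auto
  also have "\<dots> = (\<Sum>x\<in>X. \<Sum>b\<in>{b \<in> A. x \<in> b}. f x)"
    by (rule sum.swap_restrict[OF assms(2,1)])
  finally show ?thesis by simp
qed

text \<open>
  This is \<open>\<parallel>N\<^sup>T f\<parallel>\<^sup>2 = f\<^sup>T (N N\<^sup>T) f\<close> for \<open>N N\<^sup>T = (r - l) I + l J\<close>; the term with \<open>J\<close> vanishes
  because \<open>f\<close> sums to zero.
\<close>

lemma sum_block_sum_squares:
  fixes f :: "'a \<Rightarrow> real"
  assumes design: "bibd X B r k l" and zero: "sum f X = 0"
  shows "(\<Sum>b\<in>B. (\<Sum>x\<in>b. f x)\<^sup>2) = (real r - real l) * (\<Sum>x\<in>X. (f x)\<^sup>2)"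
proof -
  have fin: "finite X" and sub: "B \<subseteq> Pow X" and finB: "finite B"
    using design finite_subset[of B "Pow X"] by (auto simp: bibd_def)
  have "(\<Sum>b\<in>{b \<in> B. x \<in> b}. \<Sum>y\<in>b. f y) = (real r - real l) * f x" if x: "x \<in> X" for x
  proof -
    have "(\<Sum>b\<in>{b \<in> B. x \<in> b}. \<Sum>y\<in>b. f y) = (\<Sum>y\<in>X. card {b \<in> B. x \<in> b \<and> y \<in> b} * f y)"
      using sum_block_swap[of X "{b \<in> B. x \<in> b}" f] fin finB sub by (auto simp: conj_assoc)
    also have "\<dots> = (\<Sum>y\<in>X. l * f y + (if y = x then (real r - real l) * f y else 0))"
      using design x by (intro sum.cong) (auto simp: bibd_def algebra_simps)
    also have "\<dots> = l * sum f X + (real r - real l) * f x"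
      using fin x by (simp add: sum.distrib sum_distrib_left)
    finally show ?thesis using zero by simp
  qed
  moreover have "(\<Sum>b\<in>B. (\<Sum>x\<in>b. f x)\<^sup>2)
      = (\<Sum>b\<in>B. \<Sum>x\<in>{x \<in> X. x \<in> b}. f x * (\<Sum>y\<in>b. f y))"
  proof (rule sum.cong[OF refl])
    fix b assume "b \<in> B"
    then have "{x \<in> X. x \<in> b} = b" using sub by auto
    then show "(\<Sum>x\<in>b. f x)\<^sup>2 = (\<Sum>x\<in>{x \<in> X. x \<in> b}. f x * (\<Sum>y\<in>b. f y))"
      by (simp add: power2_eq_square sum_distrib_right)
  qed
  moreover have "\<dots> = (\<Sum>x\<in>X. f x * (\<Sum>b\<in>{b \<in> B. x \<in> b}. \<Sum>y\<in>b. f y))"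
    by (subst sum.swap_restrict[OF finB fin]) (simp add: sum_distrib_left)
  ultimately show ?thesis
    by (simp add: sum_distrib_left power2_eq_square mult.left_commute)
qed

text \<open>
  No block is all of \<open>X\<close>, so a block through \<open>x\<close> misses some \<open>y\<close>, and the blocks through both
  points are among the \<open>r\<close> blocks through \<open>x\<close>.
\<close>

lemma bibd_index_le_replication:
  assumes design: "bibd X B r k l"
  shows "l \<le> r"
proof -
  have finB: "finite B" using design finite_subset[of B "Pow X"] by (auto simp: bibd_def)
  obtain x where x: "x \<in> X" using design by (auto simp: bibd_def)
  then have rx: "card {b \<in> B. x \<in> b} = r" and "r \<ge> 1" using design by (auto simp: bibd_def)
  then have "{b \<in> B. x \<in> b} \<noteq> {}" by (metis card.empty not_one_le_zero)
  then obtain b where b: "b \<in> B" "x \<in> b" by blast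
  then have "b \<subset> X" using design by (auto simp: bibd_def)
  then obtain y where y: "y \<in> X" "y \<noteq> x" using b by blast
  then have "l = card {b \<in> B. x \<in> b \<and> y \<in> b}" using design x by (auto simp: bibd_def)
  also have "\<dots> \<le> card {b \<in> B. x \<in> b}" using finB by (intro card_mono) auto
  finally show ?thesis using rx by simp
qed

text \<open>
  Pairing \<open>f = d - \<mu>\<close> with the degree \<open>d\<close> gives \<open>\<Sum>f\<^sup>2\<close>, as \<open>f\<close> is orthogonal to constants. The
  pairing is also the total of the block sums of \<open>f\<close> over \<open>L\<close>, whose squares add up to at most
  \<open>(r - l) * \<Sum>f\<^sup>2\<close>. Cauchy-Schwarz turns this into \<open>(\<Sum>f\<^sup>2)\<^sup>2 \<le> (r - l) * card L * \<Sum>f\<^sup>2\<close>.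
\<close>

lemma degree_variance_le:
  fixes \<mu> :: real
  assumes design: "bibd X B r k l" and L: "L \<subseteq> B"
    and mean: "\<mu> * card X = card L * k"
  shows "(\<Sum>x\<in>X. (card {b \<in> L. x \<in> b} - \<mu>)\<^sup>2) \<le> (real r - real l) * card L"
    and "(\<Sum>x\<in>X. card {b \<in> L. x \<in> b} - \<mu>) = 0"
proof -
  have fin: "finite X" and sub: "B \<subseteq> Pow X" and finB: "finite B"
    using design finite_subset[of B "Pow X"] by (auto simp: bibd_def)
  have finL: "finite L" and subL: "L \<subseteq> Pow X" using L finB sub finite_subset by blast+
  define f where "f x = card {b \<in> L. x \<in> b} - \<mu>" for x
  define V where "V = (\<Sum>x\<in>X. (f x)\<^sup>2)"
  have "(\<Sum>b\<in>L. \<Sum>x\<in>b. 1 :: real) = card L * k"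
    using design L by (simp add: bibd_def subset_iff)
  then have zero: "sum f X = 0"
    using sum_block_swap[OF fin finL subL, of "\<lambda>_. 1"] mean
    by (simp add: f_def sum_subtractf mult.commute)
  have "(\<Sum>b\<in>L. \<Sum>x\<in>b. f x) = (\<Sum>x\<in>X. (f x)\<^sup>2 + \<mu> * f x)"
    unfolding sum_block_swap[OF fin finL subL]
    by (intro sum.cong) (auto simp: f_def power2_eq_square algebra_simps)
  also have "\<dots> = V" using zero by (simp add: V_def sum.distrib flip: sum_distrib_left)
  finally have "V\<^sup>2 = (\<Sum>b\<in>L. \<Sum>x\<in>b. f x)\<^sup>2" by simp
  also have "\<dots> \<le> (\<Sum>b\<in>L. (\<Sum>x\<in>b. f x)\<^sup>2) * card L" by (rule sum_squared_le_sum_of_squares)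
  also have "\<dots> \<le> (\<Sum>b\<in>B. (\<Sum>x\<in>b. f x)\<^sup>2) * card L"
    using finB L by (intro mult_right_mono sum_mono2) auto
  also have "\<dots> = V * ((real r - real l) * card L)"
    unfolding sum_block_sum_squares[OF design zero] V_def by simp
  finally have sq: "V * V \<le> V * ((real r - real l) * card L)" by (simp add: power2_eq_square)
  have "V \<ge> 0" by (simp add: V_def sum_nonneg)
  moreover have "(real r - real l) * card L \<ge> 0"
    using bibd_index_le_replication[OF design] by simp
  ultimately have "V \<le> (real r - real l) * card L"
    using sq by (cases "V = 0") auto
  then show "(\<Sum>x\<in>X. (card {b \<in> L. x \<in> b} - \<mu>)\<^sup>2) \<le> (real r - real l) * card L"
    by (simp add: V_def f_def)
  show "(\<Sum>x\<in>X. card {b \<in> L. x \<in> b} - \<mu>) = 0" using zero by (simp add: f_def)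
qed

theorem theorem4:
  fixes X :: "'a set" and B L :: "'a set set"
    and r k l t :: nat and \<epsilon> :: real
  assumes "bibd X B r k l"
    and "\<epsilon> > 0"
    and "t \<ge> 2"
    and "L \<subseteq> B"
    and "real (card L) \<ge> (1 + \<epsilon>) * (real t - 1) * (real (card X) / real k)"
  shows "real (num_rich X t L) \<ge>
    (\<epsilon>\<^sup>2 * (real t - 1)
       / (\<epsilon>\<^sup>2 * (real t - 1) + (real r - real l) / real k * (1 + \<epsilon>)))
    * real (card X)"
proof -
  have fin: "finite X" and v: "real (card X) > 0" and k: "real k > 0"
    using assms(1) by (auto simp: bibd_def card_gt_0_iff)
  define s where "s = real t - 1"
  define q where "q = (real r - real l) / real k"
  define \<mu> where "\<mu> = card L * k / card X"
  define R where "R = rich_points X t L"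
  define f where "f x = card {b \<in> L. x \<in> b} - \<mu>" for x
  have s: "s > 0" using assms(3) by (simp add: s_def)
  have q: "q \<ge> 0" using bibd_index_le_replication[OF assms(1)] by (simp add: q_def)
  have mean: "\<mu> * card X = card L * k" using v by (simp add: \<mu>_def)
  have \<mu>: "\<mu> \<ge> (1 + \<epsilon>) * s"
    using assms(5) v k by (simp add: \<mu>_def s_def field_simps)
  have "\<epsilon> * s > 0" using s assms(2) by simp
  then have \<mu>s: "\<mu> - s \<ge> 0" and \<mu>pos: "\<mu> > 0"
    using \<mu> s by (simp_all add: distrib_right)
  have subR: "R \<subseteq> X" by (auto simp: R_def rich_points_def)
  have "f x \<le> - (\<mu> - s)" if "x \<in> X - R" for x
    using that by (auto simp: f_def R_def rich_points_def s_def)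
  then have "(\<mu> - s)\<^sup>2 * card (X - R) * card X \<le> card (X - (X - R)) * (\<Sum>x\<in>X. (f x)\<^sup>2)"
    using degree_variance_le(2)[OF assms(1,4) mean] \<mu>s
    by (intro card_below_mean_le[OF fin]) (auto simp: f_def)
  also have "X - (X - R) = R" using subR by blast
  also have "card R * (\<Sum>x\<in>X. (f x)\<^sup>2) \<le> card R * ((real r - real l) * card L)"
    using degree_variance_le(1)[OF assms(1,4) mean]
    by (intro mult_left_mono) (auto simp: f_def)
  also have "\<dots> = card R * (q * \<mu>) * card X"
    using k v by (simp add: q_def \<mu>_def)
  finally have cantelli: "(\<mu> - s)\<^sup>2 * card (X - R) \<le> card R * (q * \<mu>)"
    using v by simp
  \<comment> \<open>Both \<open>(1 + \<epsilon>) (\<mu> - s) \<ge> \<epsilon> \<mu>\<close> and \<open>\<mu> \<ge> (1 + \<epsilon>) s\<close> are equalities at the least allowed mean,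
    so nothing is lost there; the remaining factor \<open>\<mu>\<close> cancels against the one in the variance.\<close>
  have "\<epsilon> * \<mu> \<le> (1 + \<epsilon>) * (\<mu> - s)" using \<mu> by (simp add: algebra_simps)
  then have "(\<epsilon> * \<mu>)\<^sup>2 \<le> ((1 + \<epsilon>) * (\<mu> - s))\<^sup>2"
    using assms(2) \<mu>pos by (intro power_mono) auto
  moreover have "\<epsilon>\<^sup>2 * \<mu> * ((1 + \<epsilon>) * s) \<le> \<epsilon>\<^sup>2 * \<mu> * \<mu>"
    using \<mu> \<mu>pos by (intro mult_left_mono) auto
  ultimately have "(1 + \<epsilon>) * (\<epsilon>\<^sup>2 * s * \<mu>) \<le> (1 + \<epsilon>) * ((1 + \<epsilon>) * (\<mu> - s)\<^sup>2)"
    by (simp add: power_mult_distrib power2_eq_square mult_ac)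
  then have "\<epsilon>\<^sup>2 * s * \<mu> \<le> (1 + \<epsilon>) * (\<mu> - s)\<^sup>2"
    using assms(2) by (simp add: mult_le_cancel_left_pos)
  then have "\<epsilon>\<^sup>2 * s * \<mu> * card (X - R) \<le> (1 + \<epsilon>) * (\<mu> - s)\<^sup>2 * card (X - R)"
    by (intro mult_right_mono) auto
  also have "\<dots> \<le> (1 + \<epsilon>) * (card R * (q * \<mu>))"
    using cantelli assms(2) by (simp add: mult.assoc)
  finally have "\<mu> * (\<epsilon>\<^sup>2 * s * card (X - R)) \<le> \<mu> * (q * (1 + \<epsilon>) * card R)"
    by (simp add: mult_ac)
  then have "\<epsilon>\<^sup>2 * s * card (X - R) \<le> q * (1 + \<epsilon>) * card R"
    using \<mu>pos by (simp add: mult_le_cancel_left_pos)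
  moreover have "real (card (X - R)) = real (card X) - real (card R)"
    using card_Diff_subset[OF finite_subset[OF subR fin] subR] card_mono[OF fin subR]
    by (simp add: of_nat_diff)
  ultimately have "\<epsilon>\<^sup>2 * s * card X \<le> card R * (\<epsilon>\<^sup>2 * s + q * (1 + \<epsilon>))"
    by (simp add: algebra_simps)
  moreover have "\<epsilon>\<^sup>2 * s + q * (1 + \<epsilon>) > 0"
    using s q assms(2) by (intro add_pos_nonneg) auto
  ultimately show ?thesis
    unfolding num_rich_def R_def[symmetric] s_def[symmetric] q_def[symmetric]
    by (simp add: divide_le_eq)
qed

end
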